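(* Let $X$ be a strictly monotone solid Banach lattice of real functions on a set $\Gamma$ with $\|e_\gamma\|=1$ for every $\gamma\in\Gamma$. (i) Assume $\mathfrak{L_F}<\infty$ and that for every $x\in X$ we have $\|x\|=\sup_{F\subset\Gamma,\,|F|<\infty}\|P_Fx\|$. If there exists $\alpha\in\Gamma$ such that $$\inf_{\beta\in\Gamma,\,\beta\neq\alpha}\left\|e_\alpha+\frac{1}{\mathfrak{L_F}}e_\beta\right\|>1,$$ then $X$ fails the local diameter two property (LD2P). In particular, any equivalent renorming of $c_0(\Gamma)$ such that the canonical basis $(e_\gamma)_{\gamma\in\Gamma}$ is strictly monotone and normalized, and there exists $\alpha\in\Gamma$ with $$\inf_{\beta\in\Gamma,\,\beta\neq\alpha}\left\|e_\alpha+\frac{1}{\mathfrak{L_F}}e_\beta\right\|>1,$$ fails the LD2P. (ii) Assume that $\Gamma=\mathbb{N}$ and that $X$ is lattice isomorphic to $\ell_\infty(\mathbb{N})$. If there exists $k\in\mathbb{N}$ such that $$\inf_{n\in\mathbb{N},\,n\neq k}\left\|e_k+\frac{1}{\mathfrak{L}}e_n\right\|>1,$$ then $X$ fails the LD2P.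
   Context: All spaces are real. A solid Banach lattice of real functions on a set $\Gamma$ is a Banach space $(X,\|\cdot\|)$ consisting of bounded functions $x:\Gamma\to\mathbb{R}$ such that: (1) if $x\in X$ and $y:\Gamma\to\mathbb{R}$ satisfies $|y(\gamma)|\le|x(\gamma)|$ for all $\gamma\in\Gamma$, then $y\in X$ and $\|y\|\le\|x\|$; (2) for every $\alpha\in\Gamma$ the function $e_\alpha$ with $e_\alpha(\alpha)=1$ and $e_\alpha(\gamma)=0$ for $\gamma\ne\alpha$ belongs to $X$. The norm of $X$ (or the system $(e_\gamma)_{\gamma\in\Gamma}$) is strictly monotone if $\|y\|<\|x\|$ whenever $|y(\gamma)|\le|x(\gamma)|$ for all $\gamma\in\Gamma$ and $|y(\beta)|<|x(\beta)|$ for some $\beta\in\Gamma$. A renorming of $c_0(\Gamma)$ whose canonical basis is normalized ($\|e_\gamma\|=1$ for all $\gamma$) and strictly monotone is such a lattice. For $A\subset\Gamma$, $\mathbb{1}_A$ denotes the characteristic function of $A$. For finite $F\subset\Gamma$, $P_F:X\to X$ is the natural projection $P_Fx=\sum_{\gamma\in F}x(\gamma)e_\gamma$. Define $$\mathfrak{L_F}=\sup\{\|\mathbb{1}_A\|: A\subset\Gamma,\ |A|<\infty\},\qquad \mathfrak{L}=\|\mathbb{1}_\Gamma\|,$$ the latter when $\mathbb{1}_\Gamma\in X$ (which is equivalent to $X$ being lattice isomorphic to $\ell_\infty(\Gamma)$). The norm used in these definitions is the norm of the space under consideration (in particular the new norm in the case of a renorming of $c_0(\Gamma)$). $B_X$,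 $S_X$ denote the closed unit ball and unit sphere. A slice of $B_X$ is a set $S(x^*,\varepsilon)=\{x\in B_X:x^*(x)>1-\varepsilon\}$ with $x^*\in S_{X^*}$, $\varepsilon>0$. $X$ has the local diameter two property (LD2P) if every slice of $B_X$ has diameter two. *)

theory Defs
  imports "HOL-Analysis.Analysis"
begin

text \<open>
  A Banach space of real functions on \<open>\<Gamma>\<close> is given by a type \<^typ>\<open>'a::banach\<close> together with a linear
  injection \<open>ev\<close> that sends an element \<open>x\<close> to its function \<open>\<gamma> \<mapsto> x(\<gamma>)\<close>; the space of functions itself is
  \<open>range ev\<close>, carrying the norm of \<^typ>\<open>'a\<close>. The index set \<open>\<Gamma>\<close> is the type \<^typ>\<open>'g\<close>.
\<close>

locale function_space =
  fixes ev :: "'a::banach \<Rightarrow> 'g \<Rightarrow> real"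
  assumes linear_ev: "linear (\<lambda>x. ev x \<gamma>)"
    and inj_ev: "inj ev"

definition char_elem :: "('a \<Rightarrow> 'g \<Rightarrow> real) \<Rightarrow> 'g set \<Rightarrow> 'a" where
  \<comment> \<open>meaningful only if the characteristic function of \<open>A\<close> lies in \<open>range ev\<close>\<close>
  "char_elem ev A = the_inv ev (indicator A)"

definition unit_elem :: "('a \<Rightarrow> 'g \<Rightarrow> real) \<Rightarrow> 'g \<Rightarrow> 'a" where
  "unit_elem ev \<alpha> = char_elem ev {\<alpha>}"

locale solid_banach_lattice = function_space ev
  for ev :: "'a::banach \<Rightarrow> 'g \<Rightarrow> real" +
  assumes bounded_ev: "bounded (range (ev x))"
    and solid: "(\<And>\<gamma>. \<bar>f \<gamma>\<bar> \<le> \<bar>ev x \<gamma>\<bar>) \<Longrightarrow> \<exists>y. ev y = f \<and> norm y \<le> norm x"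
    and unit_in_range: "indicator {\<alpha>} \<in> range ev"

definition strictly_monotone :: "('a::real_normed_vector \<Rightarrow> 'g \<Rightarrow> real) \<Rightarrow> bool" where
  "strictly_monotone ev \<longleftrightarrow>
     (\<forall>x y. (\<forall>\<gamma>. \<bar>ev y \<gamma>\<bar> \<le> \<bar>ev x \<gamma>\<bar>) \<and> (\<exists>\<beta>. \<bar>ev y \<beta>\<bar> < \<bar>ev x \<beta>\<bar>) \<longrightarrow> norm y < norm x)"

definition normalized :: "('a::real_normed_vector \<Rightarrow> 'g \<Rightarrow> real) \<Rightarrow> bool" where
  "normalized ev \<longleftrightarrow> (\<forall>\<gamma>. norm (unit_elem ev \<gamma>) = 1)"

definition proj :: "('a::real_normed_vector \<Rightarrow> 'g \<Rightarrow> real) \<Rightarrow> 'g set \<Rightarrow> 'a \<Rightarrow> 'a" where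
  "proj ev F x = (\<Sum>\<gamma>\<in>F. ev x \<gamma> *\<^sub>R unit_elem ev \<gamma>)"

text \<open>
  \<open>LF\<close> is extended-real so that its finiteness can be a hypothesis. Infima over \<open>\<beta> \<noteq> \<alpha>\<close> are likewise to be
  taken in \<^typ>\<open>ereal\<close>, so that the empty infimum (\<open>\<Gamma>\<close> a singleton) is \<open>\<infinity>\<close>.
\<close>

definition LF :: "('a::real_normed_vector \<Rightarrow> 'g \<Rightarrow> real) \<Rightarrow> ereal" where
  "LF ev = (SUP A\<in>{A. finite A}. ereal (norm (char_elem ev A)))"

definition LL :: "('a::real_normed_vector \<Rightarrow> 'g \<Rightarrow> real) \<Rightarrow> real" where
  "LL ev = norm (char_elem ev UNIV)"

definition sup_norm :: "('g \<Rightarrow> real) \<Rightarrow> real" where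
  \<comment> \<open>used for bounded functions only\<close>
  "sup_norm f = (SUP \<gamma>. \<bar>f \<gamma>\<bar>)"

definition c0 :: "('g \<Rightarrow> real) set" where
  "c0 = {f. \<forall>\<epsilon>>0. finite {\<gamma>. \<bar>f \<gamma>\<bar> \<ge> \<epsilon>}}"

definition linf :: "('g \<Rightarrow> real) set" where
  "linf = {f. bounded (range f)}"

locale c0_renorming = function_space ev
  for ev :: "'a::banach \<Rightarrow> 'g \<Rightarrow> real" +
  assumes range_ev: "range ev = c0"
    and equivalent_norm:
      "\<exists>c>0. \<exists>C>0. \<forall>x. c * sup_norm (ev x) \<le> norm x \<and> norm x \<le> C * sup_norm (ev x)"

text \<open>
  A lattice isomorphism onto \<open>\<ell>\<^sub>\<infinity>(\<Gamma>)\<close> is a linear homeomorphism preserving finite suprema and infima,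
  which in both spaces are computed pointwise.
\<close>

definition lattice_isomorphic_linf :: "('a::real_normed_vector \<Rightarrow> 'g \<Rightarrow> real) \<Rightarrow> bool" where
  "lattice_isomorphic_linf ev \<longleftrightarrow>
     (\<exists>T :: 'a \<Rightarrow> 'g \<Rightarrow> real.
        (\<forall>\<gamma>. linear (\<lambda>x. T x \<gamma>)) \<and> bij_betw T UNIV linf \<and>
        (\<exists>c>0. \<exists>C>0. \<forall>x. c * norm x \<le> sup_norm (T x) \<and> sup_norm (T x) \<le> C * norm x) \<and>
        (\<forall>x y z. (\<forall>\<gamma>. ev z \<gamma> = max (ev x \<gamma>) (ev y \<gamma>)) \<longrightarrow> (\<forall>\<gamma>. T z \<gamma> = max (T x \<gamma>) (T y \<gamma>))) \<and>
        (\<forall>x y z. (\<forall>\<gamma>. ev z \<gamma> = min (ev x \<gamma>) (ev y \<gamma>)) \<longrightarrow> (\<forall>\<gamma>. T z \<gamma> = min (T x \<gamma>) (T y \<gamma>))))"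

definition slice :: "('a::real_normed_vector \<Rightarrow>\<^sub>L real) \<Rightarrow> real \<Rightarrow> 'a set" where
  "slice f \<epsilon> = {x \<in> cball 0 1. blinfun_apply f x > 1 - \<epsilon>}"

definition LD2P :: "'a::real_normed_vector itself \<Rightarrow> bool" where
  "LD2P _ \<longleftrightarrow>
     (\<forall>(f :: 'a \<Rightarrow>\<^sub>L real) \<epsilon>. norm f = 1 \<and> \<epsilon> > 0 \<longrightarrow> diameter (slice f \<epsilon>) = 2)"

end

theory Submission
  imports Defs
begin

text \<open>
  The slice that witnesses the failure of the LD2P is cut out by the evaluation functional at \<open>\<alpha>\<close>,
  which has norm one. Let \<open>L\<close> be the norm of the constant function one (in the
  first two settings, the supremum of the norms of characteristic functions of finite sets), and suppose that \<open>\<parallel>e\<^sub>\<alpha> + e\<^sub>\<beta> / L\<parallel> \<ge> r > 1\<close> for all \<open>\<beta> \<noteq> \<alpha>\<close>. If \<open>x\<close> lies in the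
  unit ball and \<open>x(\<alpha>)\<close> is almost \<open>1\<close>, then \<open>\<bar>x(\<beta>)\<bar>\<close> cannot exceed \<open>1 / L - \<eta>\<close> for some \<open>\<eta> > 0\<close>
  depending on \<open>r\<close> only, since otherwise \<open>x\<close> dominates a function that is close to \<open>e\<^sub>\<alpha> + e\<^sub>\<beta> / L\<close>
  (\<open>coordinate_bound_in_slice\<close>). Two elements of a thin slice thus differ by little at \<open>\<alpha>\<close> and by at most
  \<open>2 / L - 2 \<eta>\<close> elsewhere. A function bounded by \<open>t\<close> has norm at most \<open>t L\<close>, so the diameter of the
  slice is at most about \<open>2 - 2 \<eta> L < 2\<close> (\<open>not_LD2P_if_norm_le_sup_bound\<close>).

  The three settings differ only in how they give the bound \<open>t L\<close>. In the first it comes from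
  the finite projections. A strictly monotone renorming of \<open>c\<^sub>0\<close> is an instance of the first setting: the
  solidity of its norm comes from strict monotonicity, applied to slightly enlarged majorants. In the third
  setting the point is that the constant function one belongs to the space, although the lattice
  isomorphism onto \<open>\<ell>\<^sub>\<infinity>\<close> need not be the identity on functions (\<open>one_in_range_if_lattice_isomorphic_linf\<close>).
\<close>

section \<open>Function spaces\<close>

context function_space
begin

lemma
  shows ev_add: "ev (x + y) \<gamma> = ev x \<gamma> + ev y \<gamma>"
    and ev_diff: "ev (x - y) \<gamma> = ev x \<gamma> - ev y \<gamma>"
    and ev_scaleR: "ev (c *\<^sub>R x) \<gamma> = c * ev x \<gamma>"
    and ev_zero: "ev 0 \<gamma> = 0"
    and ev_sum: "ev (sum h F) \<gamma> = (\<Sum>i\<in>F. ev (h i) \<gamma>)"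
  using linear_add[OF linear_ev, of x y \<gamma>] linear_diff[OF linear_ev, of x y \<gamma>]
    linear_cmul[OF linear_ev, of c x \<gamma>] linear_0[OF linear_ev, of \<gamma>] linear_sum[OF linear_ev, of h F \<gamma>]
  by simp_all

lemma ev_eqI: "(\<And>\<gamma>. ev x \<gamma> = ev y \<gamma>) \<Longrightarrow> x = y"
  using inj_ev by (metis ext injD)

lemma ev_char_elem: "indicator A \<in> range ev \<Longrightarrow> ev (char_elem ev A) = indicator A"
  unfolding char_elem_def using inj_ev f_the_inv_into_f by metis

end

section \<open>Solid lattices\<close>

context solid_banach_lattice
begin

lemma ev_unit_elem: "ev (unit_elem ev \<alpha>) \<gamma> = (if \<gamma> = \<alpha> then 1 else 0)"
  unfolding unit_elem_def using ev_char_elem[OF unit_in_range] by (simp add: indicator_def)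

lemma ev_proj: "finite F \<Longrightarrow> ev (proj ev F x) \<gamma> = (if \<gamma> \<in> F then ev x \<gamma> else 0)"
  unfolding proj_def by (simp add: ev_sum ev_scaleR ev_unit_elem if_distrib sum.delta cong: if_cong)

lemma ev_char_elem_finite:
  assumes "finite A"
  shows "ev (char_elem ev A) = indicator A"
proof -
  have "ev (\<Sum>\<gamma>\<in>A. unit_elem ev \<gamma>) = indicator A"
    using assms by (auto simp: fun_eq_iff ev_sum ev_unit_elem indicator_def sum.delta)
  then show ?thesis
    by (metis ev_char_elem rangeI)
qed

lemma norm_mono:
  assumes "\<And>\<gamma>. \<bar>ev y \<gamma>\<bar> \<le> \<bar>ev x \<gamma>\<bar>"
  shows "norm y \<le> norm x"
  using solid[OF assms] inj_ev by (metis injD)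

lemma norm_le_mult_if_dominated:
  assumes "0 \<le> t" and "\<And>\<gamma>. \<bar>ev x \<gamma>\<bar> \<le> t * \<bar>ev u \<gamma>\<bar>"
  shows "norm x \<le> t * norm u"
  using norm_mono[of x "t *\<^sub>R u"] assms by (simp add: ev_scaleR abs_mult)

lemma abs_ev_le_norm:
  assumes "normalized ev"
  shows "\<bar>ev x \<gamma>\<bar> \<le> norm x"
proof -
  have "norm (ev x \<gamma> *\<^sub>R unit_elem ev \<gamma>) \<le> norm x"
    by (rule norm_mono) (simp add: ev_scaleR ev_unit_elem)
  then show ?thesis
    using assms by (simp add: normalized_def)
qed

lemma norm_evaluation_eq_1:
  assumes "normalized ev"
  shows "bounded_linear (\<lambda>x. ev x \<alpha>)" and "norm (Blinfun (\<lambda>x. ev x \<alpha>)) = 1"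
proof -
  show bl: "bounded_linear (\<lambda>x. ev x \<alpha>)"
    using abs_ev_le_norm[OF assms, of _ \<alpha>]
    by (intro bounded_linear_intro[of _ 1]) (simp_all add: ev_add ev_scaleR)
  have le: "norm (Blinfun (\<lambda>x. ev x \<alpha>)) \<le> 1"
    using abs_ev_le_norm[OF assms, of _ \<alpha>]
    by (intro norm_blinfun_bound) (simp_all add: bounded_linear_Blinfun_apply[OF bl])
  have "norm (blinfun_apply (Blinfun (\<lambda>x. ev x \<alpha>)) (unit_elem ev \<alpha>))
      \<le> norm (Blinfun (\<lambda>x. ev x \<alpha>)) * norm (unit_elem ev \<alpha>)"
    by (rule norm_blinfun)
  then show "norm (Blinfun (\<lambda>x. ev x \<alpha>)) = 1"
    using le assms by (simp add: bounded_linear_Blinfun_apply[OF bl] ev_unit_elem normalized_def)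
qed

section \<open>The slice at a distinguished coordinate\<close>

text \<open>
  If \<open>\<bar>x(\<beta>)\<bar>\<close> were larger, then \<open>x\<close> would dominate \<open>x(\<alpha>) e\<^sub>\<alpha> + s e\<^sub>\<beta>\<close> for some \<open>s\<close> between \<open>c - \<eta>\<close> and \<open>c\<close>, and
  this function is at distance less than \<open>\<epsilon> + \<eta>\<close> from \<open>e\<^sub>\<alpha> + c e\<^sub>\<beta>\<close>.
\<close>

lemma coordinate_bound_in_slice:
  assumes nrm: "normalized ev" and "\<beta> \<noteq> \<alpha>"
    and x: "norm x \<le> 1" "1 - \<epsilon> < ev x \<alpha>"
    and "0 \<le> c" "0 \<le> \<eta>"
    and far: "1 + \<epsilon> + \<eta> \<le> norm (unit_elem ev \<alpha> + c *\<^sub>R unit_elem ev \<beta>)"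
  shows "\<bar>ev x \<beta>\<bar> \<le> c - \<eta>"
proof (rule ccontr)
  assume *: "\<not> ?thesis"
  let ?a = "unit_elem ev \<alpha>" and ?b = "unit_elem ev \<beta>"
  have one: "norm ?a = 1" "norm ?b = 1"
    using nrm by (auto simp: normalized_def)
  have x\<alpha>: "ev x \<alpha> \<le> 1"
    using abs_ev_le_norm[OF nrm, of x \<alpha>] x by simp
  define s where "s = min \<bar>ev x \<beta>\<bar> c"
  define w where "w = ev x \<alpha> *\<^sub>R ?a + s *\<^sub>R ?b"
  have "norm w \<le> norm x"
    using \<open>\<beta> \<noteq> \<alpha>\<close> \<open>0 \<le> c\<close>
    by (intro norm_mono) (simp add: w_def s_def ev_add ev_scaleR ev_unit_elem)
  moreover have "?a + c *\<^sub>R ?b = w + (1 - ev x \<alpha>) *\<^sub>R ?a + (c - s) *\<^sub>R ?b"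
    by (simp add: w_def algebra_simps)
  then have "norm (?a + c *\<^sub>R ?b) \<le> norm w + \<bar>1 - ev x \<alpha>\<bar> + \<bar>c - s\<bar>"
    using norm_triangle_ineq[of "w + (1 - ev x \<alpha>) *\<^sub>R ?a" "(c - s) *\<^sub>R ?b"]
      norm_triangle_ineq[of w "(1 - ev x \<alpha>) *\<^sub>R ?a"] one by simp
  moreover have "\<bar>c - s\<bar> \<le> \<eta>"
    using * \<open>0 \<le> \<eta>\<close> by (auto simp: s_def)
  ultimately show False
    using x x\<alpha> far by simp
qed

text \<open>
  Here \<open>L\<close> plays the part of the norm of the constant function one. The difference of two elements of the slice
  is split into its part at \<open>\<alpha>\<close>, of norm at most \<open>\<epsilon>\<close>, and the rest, which is bounded by \<open>2 (1 / L - \<eta>)\<close> and so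
  has norm at most \<open>2 - 2 \<eta> L\<close>. Since \<open>L \<ge> 1\<close>, the choice \<open>\<epsilon> \<le> \<eta>\<close> keeps the total below \<open>2\<close>.
\<close>

lemma not_LD2P_if_norm_le_sup_bound:
  assumes nrm: "normalized ev"
    and inf: "(INF \<beta>\<in>{\<beta>. \<beta> \<noteq> \<alpha>}.
      ereal (norm (unit_elem ev \<alpha> + (1 / L) *\<^sub>R unit_elem ev \<beta>))) > 1"
    and bound: "\<And>x t. 0 \<le> t \<Longrightarrow> (\<And>\<gamma>. \<bar>ev x \<gamma>\<bar> \<le> t) \<Longrightarrow> norm x \<le> t * L"
  shows "\<not> LD2P TYPE('a)"
proof
  assume ld2p: "LD2P TYPE('a)"
  have "norm (unit_elem ev \<alpha>) \<le> 1 * L"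
    by (rule bound) (simp_all add: ev_unit_elem)
  then have L: "1 \<le> L"
    using nrm by (simp add: normalized_def)
  obtain r where r: "1 < r"
    "ereal r < (INF \<beta>\<in>{\<beta>. \<beta> \<noteq> \<alpha>}. ereal (norm (unit_elem ev \<alpha> + (1 / L) *\<^sub>R unit_elem ev \<beta>)))"
    using ereal_dense2[OF inf] by (auto simp: one_ereal_def)
  have far: "r < norm (unit_elem ev \<alpha> + (1 / L) *\<^sub>R unit_elem ev \<beta>)" if "\<beta> \<noteq> \<alpha>" for \<beta>
    using less_INF_D[OF r(2), of \<beta>] that by simp
  \<comment> \<open>The gap \<open>r - 1\<close> has to accommodate both \<open>\<epsilon>\<close> and \<open>\<eta>\<close> in \<open>coordinate_bound_in_slice\<close>.\<close>
  define \<eta> where "\<eta> = (r - 1) / 2"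
  have "0 < \<eta>"
    using r(1) by (simp add: \<eta>_def)
  define \<epsilon> where "\<epsilon> = min \<eta> 1"
  \<comment> \<open>If \<open>\<alpha>\<close> is the sole index, then \<open>r\<close> can be arbitrarily large and \<open>1 / L - \<eta>\<close> can be negative.\<close>
  define t where "t = max 0 (2 * (1 / L - \<eta>))"
  have pos: "0 < \<eta>" "0 < \<epsilon>" "\<epsilon> \<le> \<eta>" "\<epsilon> \<le> 1" "0 \<le> t"
    using r(1) by (simp_all add: \<epsilon>_def t_def \<open>0 < \<eta>\<close>)
  let ?f = "Blinfun (\<lambda>x. ev x \<alpha>)"
  have f: "blinfun_apply ?f x = ev x \<alpha>" for x
    by (simp add: bounded_linear_Blinfun_apply norm_evaluation_eq_1[OF nrm])
  have small: "\<bar>ev x \<beta>\<bar> \<le> 1 / L - \<eta>" if "x \<in> slice ?f \<epsilon>" "\<beta> \<noteq> \<alpha>" for x \<beta>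
  proof (rule coordinate_bound_in_slice[OF nrm that(2)])
    show "1 + \<epsilon> + \<eta> \<le> norm (unit_elem ev \<alpha> + (1 / L) *\<^sub>R unit_elem ev \<beta>)"
      using far[OF that(2)] \<open>\<epsilon> \<le> \<eta>\<close> unfolding \<eta>_def by argo
  qed (use that pos L in \<open>auto simp: slice_def f\<close>)
  have "norm (x - y) \<le> t * L + \<epsilon>" if xy: "x \<in> slice ?f \<epsilon>" "y \<in> slice ?f \<epsilon>" for x y
  proof -
    let ?d = "ev (x - y) \<alpha> *\<^sub>R unit_elem ev \<alpha>"
    have "ev x \<alpha> \<le> 1" "ev y \<alpha> \<le> 1"
      using xy abs_ev_le_norm[OF nrm, of x \<alpha>] abs_ev_le_norm[OF nrm, of y \<alpha>] by (auto simp: slice_def)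
    then have "norm ?d \<le> \<epsilon>"
      using xy nrm by (auto simp: slice_def f ev_diff normalized_def)
    moreover have "norm (x - y - ?d) \<le> t * L"
    proof (rule bound)
      show "\<bar>ev (x - y - ?d) \<gamma>\<bar> \<le> t" for \<gamma>
        using small[OF xy(1), of \<gamma>] small[OF xy(2), of \<gamma>] pos
        by (cases "\<gamma> = \<alpha>") (auto simp: ev_diff ev_scaleR ev_unit_elem t_def)
    qed (fact pos)
    ultimately show ?thesis
      using norm_triangle_ineq[of "x - y - ?d" ?d] by simp
  qed
  then have "diameter (slice ?f \<epsilon>) \<le> t * L + \<epsilon>"
    using pos L by (intro diameter_le) auto
  moreover have "t * L + \<epsilon> < 2"
  proof (cases "t = 0")
    case False
    then have "t * L = 2 - 2 * (\<eta> * L)"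
      using L by (simp add: t_def max_def field_simps split: if_splits)
    moreover have "\<eta> \<le> \<eta> * L"
      using pos L by simp
    ultimately show ?thesis
      using pos by linarith
  qed (use pos in simp)
  ultimately show False
    using ld2p pos norm_evaluation_eq_1(2)[OF nrm] unfolding LD2P_def by force
qed

section \<open>Norms determined by finite projections\<close>

lemma not_LD2P_if_norm_determined_by_projections:
  assumes nrm: "normalized ev" and fin: "LF ev < \<infinity>"
    and proj: "\<And>x. norm x = (SUP F\<in>{F. finite F}. norm (proj ev F x))"
    and inf: "(INF \<beta>\<in>{\<beta>. \<beta> \<noteq> \<alpha>}.
      ereal (norm (unit_elem ev \<alpha> + (1 / real_of_ereal (LF ev)) *\<^sub>R unit_elem ev \<beta>))) > 1"
  shows "\<not> LD2P TYPE('a)"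
proof (rule not_LD2P_if_norm_le_sup_bound[OF nrm inf])
  fix x t
  assume t: "0 \<le> t" and le: "\<And>\<gamma>. \<bar>ev x \<gamma>\<bar> \<le> t"
  have char_le: "ereal (norm (char_elem ev F)) \<le> LF ev" if "finite F" for F
    unfolding LF_def using that by (intro SUP_upper) simp
  have "norm (proj ev F x) \<le> t * real_of_ereal (LF ev)" if F: "finite F" for F
  proof -
    have "norm (proj ev F x) \<le> t * norm (char_elem ev F)"
      using F le t by (intro norm_le_mult_if_dominated) (simp_all add: ev_proj ev_char_elem_finite)
    also have "\<dots> \<le> t * real_of_ereal (LF ev)"
      using char_le[OF F] fin t by (cases "LF ev") (auto intro: mult_left_mono)
    finally show ?thesis .
  qed
  then show "norm x \<le> t * real_of_ereal (LF ev)"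
    unfolding proj[of x] by (intro cSUP_least) auto
qed

section \<open>Lattices isomorphic to the bounded functions\<close>

text \<open>
  Let \<open>T\<close> be the isomorphism and \<open>T u = 1\<close>. The elements \<open>T e\<^sub>\<gamma>\<close> are bounded by a common constant \<open>C\<close>, so
  \<open>T e\<^sub>\<gamma> \<le> T (C u)\<close>. Being a lattice isomorphism, \<open>T\<close> reflects the order, and \<open>e\<^sub>\<gamma> \<le> C u\<close> for every \<open>\<gamma>\<close>. Hence
  \<open>C u\<close> dominates the constant function one.
\<close>

lemma one_in_range_if_lattice_isomorphic_linf:
  assumes nrm: "normalized ev" and iso: "lattice_isomorphic_linf ev"
  shows "indicator UNIV \<in> range ev"
proof -
  obtain T :: "'a \<Rightarrow> 'g \<Rightarrow> real" and C where lin: "\<And>\<gamma>. linear (\<lambda>x. T x \<gamma>)"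
    and bij: "bij_betw T UNIV linf"
    and C: "\<And>x. sup_norm (T x) \<le> C * norm x"
    and max: "\<And>x y z \<gamma>. (\<And>\<gamma>. ev z \<gamma> = max (ev x \<gamma>) (ev y \<gamma>)) \<Longrightarrow> T z \<gamma> = max (T x \<gamma>) (T y \<gamma>)"
    using iso unfolding lattice_isomorphic_linf_def by metis
  have reflect: "ev x \<gamma> \<le> ev y \<gamma>" if le: "\<And>\<gamma>. T x \<gamma> \<le> T y \<gamma>" for x y \<gamma>
  proof -
    \<comment> \<open>The pointwise maximum is in the space by solidity, as \<open>\<bar>x\<bar> + \<bar>y\<bar>\<close> dominates it.\<close>
    obtain x' y' where abs: "ev x' = (\<lambda>\<gamma>. \<bar>ev x \<gamma>\<bar>)" "ev y' = (\<lambda>\<gamma>. \<bar>ev y \<gamma>\<bar>)"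
      using solid[of "\<lambda>\<gamma>. \<bar>ev x \<gamma>\<bar>" x] solid[of "\<lambda>\<gamma>. \<bar>ev y \<gamma>\<bar>" y] by auto
    obtain z where z: "ev z = (\<lambda>\<gamma>. max (ev x \<gamma>) (ev y \<gamma>))"
      using solid[of "\<lambda>\<gamma>. max (ev x \<gamma>) (ev y \<gamma>)" "x' + y'"] abs by (force simp: ev_add)
    have "T z = T y"
      using max[of z x y] z le by (auto simp: fun_eq_iff max_def intro: antisym)
    then have "z = y"
      using bij by (simp add: bij_betw_def inj_eq)
    then show ?thesis
      using z by (metis max.cobounded1)
  qed
  have "(\<lambda>_. 1) \<in> (linf :: ('g \<Rightarrow> real) set)"
    by (simp add: linf_def image_constant_conv)
  then obtain u where u: "T u = (\<lambda>_. 1)"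
    using bij unfolding bij_betw_def by (metis imageE)
  have "1 \<le> ev (C *\<^sub>R u) \<gamma>" for \<gamma>
  proof -
    have "T (unit_elem ev \<gamma>) \<delta> \<le> T (C *\<^sub>R u) \<delta>" for \<delta>
    proof -
      have "T (unit_elem ev \<gamma>) \<in> linf"
        using bij by (auto simp: bij_betw_def)
      then have "bdd_above (range (\<lambda>\<delta>. \<bar>T (unit_elem ev \<gamma>) \<delta>\<bar>))"
        by (auto simp: linf_def bounded_iff bdd_above_def)
      then have "\<bar>T (unit_elem ev \<gamma>) \<delta>\<bar> \<le> sup_norm (T (unit_elem ev \<gamma>))"
        unfolding sup_norm_def by (intro cSUP_upper) auto
      also have "\<dots> \<le> C"
        using C[of "unit_elem ev \<gamma>"] nrm by (simp add: normalized_def)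
      finally show ?thesis
        using linear_cmul[OF lin, of C u \<delta>] u by simp
    qed
    then show ?thesis
      using reflect[of "unit_elem ev \<gamma>" "C *\<^sub>R u" \<gamma>] by (simp add: ev_unit_elem)
  qed
  then have "\<bar>indicator UNIV \<gamma>\<bar> \<le> \<bar>ev (C *\<^sub>R u) \<gamma>\<bar>" for \<gamma>
    by (metis abs_ge_self abs_one indicator_UNIV order_trans)
  from solid[OF this] show ?thesis
    by (metis rangeI)
qed

lemma not_LD2P_if_lattice_isomorphic_linf:
  assumes nrm: "normalized ev" and iso: "lattice_isomorphic_linf ev"
    and inf: "(INF \<beta>\<in>{\<beta>. \<beta> \<noteq> \<alpha>}.
      ereal (norm (unit_elem ev \<alpha> + (1 / LL ev) *\<^sub>R unit_elem ev \<beta>))) > 1"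
  shows "\<not> LD2P TYPE('a)"
proof (rule not_LD2P_if_norm_le_sup_bound[OF nrm inf])
  fix x t
  assume "0 \<le> t" "\<And>\<gamma>. \<bar>ev x \<gamma>\<bar> \<le> t"
  then show "norm x \<le> t * LL ev"
    unfolding LL_def
    using ev_char_elem[OF one_in_range_if_lattice_isomorphic_linf[OF nrm iso]]
    by (intro norm_le_mult_if_dominated) simp_all
qed

end

section \<open>Renormings of the null functions\<close>

lemma c0_dominated:
  assumes "g \<in> c0" "\<And>\<gamma>. \<bar>f \<gamma>\<bar> \<le> \<bar>g \<gamma>\<bar>"
  shows "f \<in> c0"
proof -
  have "finite {\<gamma>. \<epsilon> \<le> \<bar>f \<gamma>\<bar>}" if "0 < \<epsilon>" for \<epsilon>
  proof (rule finite_subset)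
    show "{\<gamma>. \<epsilon> \<le> \<bar>f \<gamma>\<bar>} \<subseteq> {\<gamma>. \<epsilon> \<le> \<bar>g \<gamma>\<bar>}"
      using order_trans[OF _ assms(2)] by (intro Collect_mono impI)
    show "finite {\<gamma>. \<epsilon> \<le> \<bar>g \<gamma>\<bar>}"
      using assms(1) that by (simp add: c0_def)
  qed
  then show ?thesis
    by (simp add: c0_def)
qed

lemma c0_bounded:
  assumes "f \<in> c0"
  shows "bounded (range f)"
proof -
  have "finite {\<gamma>. 1 \<le> \<bar>f \<gamma>\<bar>}"
    using assms by (simp add: c0_def)
  then have "bounded (f ` {\<gamma>. 1 \<le> \<bar>f \<gamma>\<bar>} \<union> {-1..1})"
    by (simp add: finite_imp_bounded)
  then show ?thesis
    by (rule bounded_subset) force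
qed

context c0_renorming
begin

text \<open>
  Strict monotonicity requires strict domination at some coordinate, which fails for instance if \<open>\<bar>y\<bar> = \<bar>x\<bar>\<close>.
  Comparing \<open>y\<close> with \<open>z x\<close> for \<open>z > 1\<close> and letting \<open>z\<close> tend to \<open>1\<close> covers this case.
\<close>

lemma norm_mono_if_strictly_monotone:
  assumes sm: "strictly_monotone ev" and le: "\<And>\<gamma>. \<bar>ev y \<gamma>\<bar> \<le> \<bar>ev x \<gamma>\<bar>"
  shows "norm y \<le> norm x"
proof (cases "\<exists>\<gamma>. ev x \<gamma> \<noteq> 0")
  case True
  then obtain \<beta> where \<beta>: "ev x \<beta> \<noteq> 0" ..
  have "norm y \<le> norm x * z" if "1 < z" for z
  proof -
    have "\<bar>ev y \<gamma>\<bar> \<le> \<bar>ev (z *\<^sub>R x) \<gamma>\<bar>" for \<gamma>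
      using order_trans[OF le[of \<gamma>], of "z * \<bar>ev x \<gamma>\<bar>"] mult_right_mono[of 1 z "\<bar>ev x \<gamma>\<bar>"] that
      by (simp add: ev_scaleR abs_mult)
    moreover have "\<bar>ev y \<beta>\<bar> < \<bar>ev (z *\<^sub>R x) \<beta>\<bar>"
      using le_less_trans[OF le[of \<beta>], of "z * \<bar>ev x \<beta>\<bar>"] mult_strict_right_mono[of 1 z "\<bar>ev x \<beta>\<bar>"] that \<beta>
      by (simp add: ev_scaleR abs_mult)
    ultimately have "norm y < norm (z *\<^sub>R x)"
      using sm unfolding strictly_monotone_def by blast
    then show ?thesis
      using that by (simp add: mult.commute)
  qed
  then show ?thesis
    by (intro tendsto_lowerbound[of "\<lambda>z. norm x * z" "norm x" "at_right 1"])
      (auto intro!: tendsto_eq_intros eventually_at_right_less simp: eventually_at_filter)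
next
  case False
  then have "y = 0"
    using le by (intro ev_eqI) (simp add: ev_zero)
  then show ?thesis
    by simp
qed

lemma solid_banach_lattice_if_strictly_monotone:
  assumes sm: "strictly_monotone ev"
  shows "solid_banach_lattice ev"
proof
  show "bounded (range (ev x))" for x
    using range_ev by (intro c0_bounded) blast
  show "\<exists>y. ev y = f \<and> norm y \<le> norm x" if le: "\<And>\<gamma>. \<bar>f \<gamma>\<bar> \<le> \<bar>ev x \<gamma>\<bar>" for f x
  proof -
    have "f \<in> range ev"
      using range_ev le by (metis c0_dominated rangeI)
    then obtain y where "f = ev y" ..
    then show ?thesis
      using norm_mono_if_strictly_monotone[OF sm, of y x] le by blast
  qed
  have "{\<gamma>. \<epsilon> \<le> \<bar>indicator {\<alpha>} \<gamma> :: real\<bar>} \<subseteq> {\<alpha>}" if "0 < \<epsilon>" for \<epsilon> and \<alpha> :: 'g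
    using that by (auto simp: indicator_def split: if_splits)
  then have "indicator {\<alpha>} \<in> c0" for \<alpha> :: 'g
    unfolding c0_def using finite_subset by blast
  then show "indicator {\<alpha>} \<in> range ev" for \<alpha>
    by (simp add: range_ev)
qed

lemma norm_le_sup_bound:
  obtains C where "0 < C" "\<And>x t. (\<And>\<gamma>. \<bar>ev x \<gamma>\<bar> \<le> t) \<Longrightarrow> norm x \<le> C * t"
proof -
  obtain C where C: "0 < C" "\<And>x. norm x \<le> C * sup_norm (ev x)"
    using equivalent_norm by blast
  have "norm x \<le> C * t" if "\<And>\<gamma>. \<bar>ev x \<gamma>\<bar> \<le> t" for x t
  proof -
    have "sup_norm (ev x) \<le> t"
      unfolding sup_norm_def using that by (intro cSUP_least) auto
    then show ?thesis
      using C by (meson mult_left_mono order_trans less_imp_le)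
  qed
  with C(1) show ?thesis
    by (rule that)
qed

lemma LF_finite:
  assumes "solid_banach_lattice ev"
  shows "LF ev < \<infinity>"
proof -
  interpret solid_banach_lattice ev by fact
  obtain C where C: "\<And>x t. (\<And>\<gamma>. \<bar>ev x \<gamma>\<bar> \<le> t) \<Longrightarrow> norm x \<le> C * t"
    using norm_le_sup_bound by metis
  have "LF ev \<le> ereal (C * 1)"
    unfolding LF_def using C[of _ 1]
    by (intro SUP_least) (simp add: ev_char_elem_finite indicator_def)
  then show ?thesis
    by (cases "LF ev") simp_all
qed

text \<open>
  Off the finite set where \<open>\<bar>x\<bar>\<close> reaches a given threshold, \<open>x\<close> is uniformly small, hence small in the
  equivalent norm. So the finite projections of \<open>x\<close> approximate \<open>x\<close>.
\<close>

lemma norm_eq_SUP_proj: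
  assumes "solid_banach_lattice ev"
  shows "norm x = (SUP F\<in>{F. finite F}. norm (proj ev F x))"
proof (rule antisym)
  interpret solid_banach_lattice ev by fact
  have le: "norm (proj ev F x) \<le> norm x" if "finite F" for F
    using that by (intro norm_mono) (simp add: ev_proj)
  then show "(SUP F\<in>{F. finite F}. norm (proj ev F x)) \<le> norm x"
    by (intro cSUP_least) auto
  obtain C where C: "0 < C" "\<And>x t. (\<And>\<gamma>. \<bar>ev x \<gamma>\<bar> \<le> t) \<Longrightarrow> norm x \<le> C * t"
    using norm_le_sup_bound by metis
  show "norm x \<le> (SUP F\<in>{F. finite F}. norm (proj ev F x))"
  proof (rule field_le_epsilon)
    fix \<delta> :: real
    assume \<delta>: "0 < \<delta>"
    define F where "F = {\<gamma>. \<delta> / C \<le> \<bar>ev x \<gamma>\<bar>}"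
    have "ev x \<in> c0"
      using range_ev by blast
    then have F: "finite F"
      using \<delta> C(1) by (simp add: F_def c0_def)
    have "norm (x - proj ev F x) \<le> C * (\<delta> / C)"
      using F \<delta> C(1) by (intro C(2)) (auto simp: ev_diff ev_proj F_def)
    moreover have "norm (proj ev F x) \<le> (SUP F\<in>{F. finite F}. norm (proj ev F x))"
      using F le by (intro cSUP_upper bdd_aboveI[of _ "norm x"]) auto
    ultimately show "norm x \<le> (SUP F\<in>{F. finite F}. norm (proj ev F x)) + \<delta>"
      using norm_triangle_ineq[of "x - proj ev F x" "proj ev F x"] C(1) by simp
  qed
qed

end

section \<open>Failure of the local diameter two property\<close>

theorem theorem4p1:
  fixes X :: "'a::banach \<Rightarrow> 'g \<Rightarrow> real"
    and Y :: "'b::banach \<Rightarrow> 'h \<Rightarrow> real"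
    and Z :: "'c::banach \<Rightarrow> nat \<Rightarrow> real"
  shows
    "(solid_banach_lattice X \<and> strictly_monotone X \<and> normalized X \<and>
      LF X < \<infinity> \<and>
      (\<forall>x. norm x = (SUP F\<in>{F. finite F}. norm (proj X F x))) \<and>
      (\<exists>\<alpha>. (INF \<beta>\<in>{\<beta>. \<beta> \<noteq> \<alpha>}.
              ereal (norm (unit_elem X \<alpha> + (1 / real_of_ereal (LF X)) *\<^sub>R unit_elem X \<beta>))) > 1)
      \<longrightarrow> \<not> LD2P TYPE('a))
     \<and>
     (c0_renorming Y \<and> strictly_monotone Y \<and> normalized Y \<and>
      (\<exists>\<alpha>. (INF \<beta>\<in>{\<beta>. \<beta> \<noteq> \<alpha>}.
              ereal (norm (unit_elem Y \<alpha> + (1 / real_of_ereal (LF Y)) *\<^sub>R unit_elem Y \<beta>))) > 1)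
      \<longrightarrow> \<not> LD2P TYPE('b))
     \<and>
     (solid_banach_lattice Z \<and> strictly_monotone Z \<and> normalized Z \<and>
      lattice_isomorphic_linf Z \<and>
      (\<exists>k. (INF n\<in>{n. n \<noteq> k}.
              ereal (norm (unit_elem Z k + (1 / LL Z) *\<^sub>R unit_elem Z n))) > 1)
      \<longrightarrow> \<not> LD2P TYPE('c))"
proof (intro conjI impI)
  assume "solid_banach_lattice X \<and> strictly_monotone X \<and> normalized X \<and>
      LF X < \<infinity> \<and>
      (\<forall>x. norm x = (SUP F\<in>{F. finite F}. norm (proj X F x))) \<and>
      (\<exists>\<alpha>. (INF \<beta>\<in>{\<beta>. \<beta> \<noteq> \<alpha>}.
              ereal (norm (unit_elem X \<alpha> + (1 / real_of_ereal (LF X)) *\<^sub>R unit_elem X \<beta>))) > 1)"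
  then show "\<not> LD2P TYPE('a)"
    using solid_banach_lattice.not_LD2P_if_norm_determined_by_projections[of X] by blast
next
  assume "c0_renorming Y \<and> strictly_monotone Y \<and> normalized Y \<and>
      (\<exists>\<alpha>. (INF \<beta>\<in>{\<beta>. \<beta> \<noteq> \<alpha>}.
              ereal (norm (unit_elem Y \<alpha> + (1 / real_of_ereal (LF Y)) *\<^sub>R unit_elem Y \<beta>))) > 1)"
  then show "\<not> LD2P TYPE('b)"
    using solid_banach_lattice.not_LD2P_if_norm_determined_by_projections[of Y]
      c0_renorming.solid_banach_lattice_if_strictly_monotone[of Y]
      c0_renorming.LF_finite[of Y] c0_renorming.norm_eq_SUP_proj[of Y] by blast
next
  assume "solid_banach_lattice Z \<and> strictly_monotone Z \<and> normalized Z \<and>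
      lattice_isomorphic_linf Z \<and>
      (\<exists>k. (INF n\<in>{n. n \<noteq> k}.
              ereal (norm (unit_elem Z k + (1 / LL Z) *\<^sub>R unit_elem Z n))) > 1)"
  then show "\<not> LD2P TYPE('c)"
    using solid_banach_lattice.not_LD2P_if_lattice_isomorphic_linf[of Z] by blast
qed

end
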